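(* Let $\sigma=\sigma_1\sigma_2\dots\sigma_n$ be a permutation of size $n$ ending with its maximum (i.e. $\sigma_n=n$), and let $P$ be the set produced from $\sigma$ by the preimage procedure described in the context. Then $P$ is the set of preimages of $\sigma$ under the bubblesort operator $\mathbf{B}$, that is, $P=\mathbf{B}^{-1}(\sigma)$.
   Context: A permutation of size $n$ is a sequence $\pi=\pi_1\pi_2\dots\pi_n$ containing each of $1,\dots,n$ exactly once. An element $\pi_j$ is a left-to-right maximum of $\pi$ if $\pi_j>\pi_i$ for all $i<j$. The bubblesort operator $\mathbf{B}$ is one pass of the bubblesort algorithm: scan the positions from left to right, each time exchanging the current element with the one to its right whenever the latter is smaller. Equivalently, writing $\pi=\mu_1A_1\mu_2A_2\dots\mu_kA_k$ where the $\mu_i$ are all the left-to-right maxima of $\pi$ (and the $A_i$ are possibly empty sequences), $\mathbf{B}(\pi)=A_1\mu_1A_2\mu_2\dots A_k\mu_k$. $\mathbf{B}^{-1}(\sigma)$ denotes the set of permutations $\pi$ with $\mathbf{B}(\pi)=\sigma$. Preimage procedure: start with $P=\{\sigma\}$. For each $i$ from $n$ down to $2$ (in this order), process every $\pi$ that belongs to $P$ at the beginning of step $i$ as follows. If $\pi_{i-1}$ is not a left-to-right maximum of $\pi$, replace $\pi$ in $P$ by the permutation obtained from $\pi$ by swapping $\pi_{i-1}$ and $\pi_i$. If $\pi_{i-1}$ is a left-to-right maximum of $\pi$, keep $\pi$ in $P$ and in addition add to $P$ the permutation obtained from $\pi$ by swapping $\pi_{i-1}$ and $\pi_i$. The set produced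 is $P$ after step $i=2$. *)

theory Defs
  imports "HOL-Combinatorics.Multiset_Permutations"
begin

text \<open>
  A permutation of size $n$ is a list in one-line notation, i.e. an element of
  \<open>permutations_of_set {1..n}\<close>. List indices start at 0, so the entry $\pi_j$ is \<open>\<pi> ! (j - 1)\<close>.
\<close>

definition ltr_max :: "nat list \<Rightarrow> nat \<Rightarrow> bool" where
  "ltr_max \<pi> k \<longleftrightarrow> k < length \<pi> \<and> (\<forall>i<k. \<pi> ! i < \<pi> ! k)"

definition swap_adj :: "nat list \<Rightarrow> nat \<Rightarrow> nat list" where
  "swap_adj \<pi> k = \<pi>[k := \<pi> ! Suc k, Suc k := \<pi> ! k]"

text \<open>
  One left-to-right pass of bubblesort: the head of the argument is the current element. If it is
  exchanged with its right neighbour, it is again the current element at the next position.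
\<close>

fun bubble :: "nat list \<Rightarrow> nat list" where
  "bubble [] = []"
| "bubble [x] = [x]"
| "bubble (x # y # xs) = (if y < x then y # bubble (x # xs) else x # bubble (y # xs))"

definition bubble_preimages :: "nat list \<Rightarrow> nat list set" where
  "bubble_preimages \<sigma> = {\<pi>. (\<exists>m. \<pi> \<in> permutations_of_set {1..m}) \<and> bubble \<pi> = \<sigma>}"

text \<open>
  Step $i$ of the preimage procedure, for $2 \le i \le n$. The entries $\pi_{i-1}$ and $\pi_i$ have
  list indices \<open>i - 2\<close> and \<open>i - 1\<close>.
\<close>

definition preimage_step :: "nat \<Rightarrow> nat list set \<Rightarrow> nat list set" where
  "preimage_step i P =
     (\<Union>\<pi>\<in>P. if ltr_max \<pi> (i - 2) then {\<pi>, swap_adj \<pi> (i - 2)} else {swap_adj \<pi> (i - 2)})"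

definition preimage_procedure :: "nat list \<Rightarrow> nat list set" where
  "preimage_procedure \<sigma> = fold preimage_step (rev [2..<Suc (length \<sigma>)]) {\<sigma>}"

end

theory Submission
  imports Defs
begin

text \<open>
  Bubblesort carries the maximum \<open>c\<close> of the prefix read so far and emits the smaller of \<open>c\<close> and the
  next entry. Run backwards from a prefix \<open>v d c\<close> of the output, the last entry read was either
  \<open>d\<close>, with \<open>c\<close> already being carried, or \<open>c\<close>, with \<open>d\<close> carried before; the latter is possible
  exactly if \<open>d\<close> exceeds all of \<open>v\<close>. These are the two branches of the preimage procedure, whose
  steps leave the prefix to the left of the carried entry equal to that of \<open>\<sigma>\<close>.
\<close>

lemma mset_bubble [simp]: "mset (bubble xs) = mset xs"
  by (induction xs rule: bubble.induct) auto

lemma set_bubble [simp]: "set (bubble xs) = set xs"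
  by (metis mset_bubble set_mset_mset)

lemma bubble_eq_Nil_iff [simp]: "bubble xs = [] \<longleftrightarrow> xs = []"
  by (metis mset_bubble mset_zero_iff)

text \<open>The recursion consumes the list from the left, so \<open>x\<close> is met only at the
  end, where it is compared with the carried entry \<open>last (bubble xs)\<close>.\<close>

lemma bubble_snoc:
  assumes "xs \<noteq> []"
  shows "bubble (xs @ [x]) =
    butlast (bubble xs) @ [min (last (bubble xs)) x, max (last (bubble xs)) x]"
  using assms by (induction xs rule: bubble.induct) (auto simp: min_def max_def)

text \<open>Each entry read replaces the carried one by the larger of the two.\<close>

lemma le_last_bubble:
  assumes "y \<in> set xs"
  shows "y \<le> last (bubble xs)"
  using assms
proof (induction xs arbitrary: y rule: rev_induct)
  case (snoc x xs)
  show ?case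
  proof (cases "xs = []")
    case False
    then show ?thesis
      using snoc by (auto simp: bubble_snoc le_max_iff_disj)
  qed (use snoc in auto)
qed simp

lemma bubble_eq_snoc2_iff:
  assumes "distinct (v @ [d, c])" "d < c"
  shows "bubble q = v @ [d, c] \<longleftrightarrow>
    (\<exists>p. q = p @ [d] \<and> bubble p = v @ [c]) \<or>
    (\<exists>p. q = p @ [c] \<and> bubble p = v @ [d] \<and> (\<forall>y\<in>set v. y < d))"
    (is "?L \<longleftrightarrow> ?R")
proof
  assume L: ?L
  then have "length q = length v + 2"
    by (metis mset_bubble size_mset length_append length_Cons list.size(3) numeral_2_eq_2)
  then obtain p x where q: "q = p @ [x]" and "length p = length v + 1"
    by (cases q rule: rev_cases) auto
  then have "p \<noteq> []"
    by auto
  define e where "e = last (bubble p)"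
  have bp: "bubble p = butlast (bubble p) @ [e]"
    using \<open>p \<noteq> []\<close> by (simp add: e_def)
  have "butlast (bubble p) @ [min e x, max e x] = v @ [d, c]"
    using L \<open>p \<noteq> []\<close> by (simp add: q bubble_snoc e_def)
  then have v: "butlast (bubble p) = v" and "min e x = d" "max e x = c"
    by auto
  then consider "e = c" "x = d" | "e = d" "x = c"
    by (auto simp: min_def max_def split: if_splits)
  then show ?R
  proof cases
    case 1
    then show ?thesis using q bp v by auto
  next
    case 2
    \<comment> \<open>The carried entry \<open>e = d\<close> bounds all of \<open>p\<close>, which
      contains \<open>v\<close>; distinctness makes the bound strict.\<close>
    have "y < d" if "y \<in> set v" for y
    proof -
      have "y \<in> set p"
        using that bp v by (metis set_bubble UnCI set_append)
      then have "y \<le> d"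
        using le_last_bubble e_def 2 by blast
      moreover have "y \<noteq> d"
        using that assms by auto
      ultimately show ?thesis by simp
    qed
    then show ?thesis using 2 q bp v by auto
  qed
next
  assume ?R
  then show ?L
  proof (elim disjE exE conjE)
    fix p assume "q = p @ [d]" "bubble p = v @ [c]"
    then show ?L
      using assms bubble_snoc[of p d] by (cases "p = []") auto
  next
    fix p assume "q = p @ [c]" "bubble p = v @ [d]"
    then show ?L
      using assms bubble_snoc[of p c] by (cases "p = []") auto
  qed
qed

text \<open>Members of the set are processed independently, so the two branches of a step can be
  followed separately.\<close>

lemma fold_preimage_step_Un:
  "fold preimage_step is (P \<union> Q) = fold preimage_step is P \<union> fold preimage_step is Q"
  by (induction "is" arbitrary: P Q) (simp_all only: fold_simps comp_apply id_apply preimage_step_def UN_Un)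

lemma ltr_max_append_Cons:
  "ltr_max (v @ d # r) (length v) \<longleftrightarrow> (\<forall>y\<in>set v. y < d)"
  by (auto simp: ltr_max_def nth_append all_set_conv_all_nth)

lemma swap_adj_append:
  "swap_adj (v @ d # c # r) (length v) = v @ c # d # r"
  by (simp add: swap_adj_def nth_append list_update_append)

text \<open>Here \<open>c\<close> is carried and \<open>r\<close> is the end of the preimage already
  fixed. Both vary in the induction: a swap moves \<open>d\<close> into \<open>r\<close>, while
  keeping the list moves \<open>c\<close> into \<open>r\<close> and makes \<open>d\<close> the
  carried entry.\<close>

lemma fold_preimage_step_eq:
  assumes "distinct (w @ [c])" "\<forall>y\<in>set w. y < c"
  shows "fold preimage_step (rev [2..<length w + 2]) {w @ c # r} =
    {p @ r | p. bubble p = w @ [c]}"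
  using assms
proof (induction w arbitrary: c r rule: rev_induct)
  case Nil
  have "bubble p = [c] \<longleftrightarrow> p = [c]" for p
    by (metis bubble.simps(2) mset_bubble mset_single_iff)
  then show ?case by simp
next
  case (snoc d v)
  let ?F = "fold preimage_step (rev [2..<length v + 2])"
  \<comment> \<open>The first step has \<open>i - 2 = length v\<close>, the index of
    \<open>d\<close>.\<close>
  have step: "rev [2..<length (v @ [d]) + 2] = (length v + 2) # rev [2..<length v + 2]"
    by simp
  have swapped: "?F {v @ c # d # r} = {p @ d # r | p. bubble p = v @ [c]}"
    using snoc by auto
  note preimages = bubble_eq_snoc2_iff[of v d c]
  show ?case
  proof (cases "\<forall>y\<in>set v. y < d")
    case True
    then have kept: "?F {v @ d # c # r} = {p @ c # r | p. bubble p = v @ [d]}"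
      using snoc by auto
    have "fold preimage_step (rev [2..<length (v @ [d]) + 2]) {(v @ [d]) @ c # r} =
        ?F ({v @ d # c # r} \<union> {v @ c # d # r})"
      using True unfolding step
      by (simp add: preimage_step_def ltr_max_append_Cons swap_adj_append insert_commute)
    also have "\<dots> = {p @ c # r | p. bubble p = v @ [d]} \<union> {p @ d # r | p. bubble p = v @ [c]}"
      by (simp only: fold_preimage_step_Un kept swapped)
    also have "\<dots> = {p @ r | p. bubble p = (v @ [d]) @ [c]}"
      using preimages snoc.prems True by fastforce
    finally show ?thesis .
  next
    case False
    have "fold preimage_step (rev [2..<length (v @ [d]) + 2]) {(v @ [d]) @ c # r} =
        ?F {v @ c # d # r}"
      using False unfolding step
      by (simp add: preimage_step_def ltr_max_append_Cons swap_adj_append)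
    \<comment> \<open>Some entry of \<open>v\<close> exceeds \<open>d\<close>, which rules out the
      second alternative of \<open>preimages\<close>.\<close>
    also have "\<dots> = {p @ r | p. bubble p = (v @ [d]) @ [c]}"
      unfolding swapped using preimages snoc.prems False by fastforce
    finally show ?thesis .
  qed
qed

theorem theorem2p2:
  fixes n :: nat and \<sigma> :: "nat list"
  assumes "n \<ge> 1"
    and "\<sigma> \<in> permutations_of_set {1..n}"
    and "\<sigma> ! (n - 1) = n"
  shows "preimage_procedure \<sigma> = bubble_preimages \<sigma>"
proof -
  have \<sigma>: "set \<sigma> = {1..n}" "distinct \<sigma>"
    using assms(2) by (auto simp: permutations_of_set_def)
  then have len: "length \<sigma> = n"
    by (metis card_atLeastAtMost diff_Suc_1 distinct_card)
  then have "\<sigma> \<noteq> []"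
    using assms(1) by auto
  moreover from this have "last \<sigma> = n"
    using assms(3) len by (simp add: last_conv_nth)
  ultimately obtain w where w: "\<sigma> = w @ [n]"
    by (metis append_butlast_last_id)
  have "y < n" if "y \<in> set w" for y
  proof -
    have "y \<in> {1..n}" "y \<noteq> n" using \<sigma> w that by auto
    then show ?thesis by simp
  qed
  then have "preimage_procedure \<sigma> = {p. bubble p = \<sigma>}"
    using fold_preimage_step_eq[of w n "[]"] \<sigma>(2) by (simp add: preimage_procedure_def w)
  \<comment> \<open>A pass only rearranges entries, so any list mapped to \<sigma> is itself a
    permutation of size \<open>n\<close>.\<close>
  moreover have "p \<in> permutations_of_set {1..n}" if "bubble p = \<sigma>" for p
    using that \<sigma> by (metis mset_bubble mset_eq_imp_distinct_iff permutations_of_setI set_bubble)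
  ultimately show ?thesis
    by (auto simp: bubble_preimages_def)
qed

end
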